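(* Let $G$ be a graph without isolated vertices, with $m\ge1$ edges and spectral radius $\lambda$. Then $$\operatorname{bk}(G)\ \ge\ 2\lambda-\frac{2m}{\lambda}.$$ Equality holds if and only if $G$ is complete bipartite, or regular complete multipartite.
   Context: Graphs are finite and simple. The spectral radius of $G$ is the spectral radius of its adjacency matrix. The booksize is $\operatorname{bk}(G)=\max_{uv\in E(G)}|N(u)\cap N(v)|$, the maximum number of triangles sharing a common edge. A regular complete multipartite graph is a complete multipartite graph all of whose parts have the same size. *)

theory Defs
  imports
    "Graph_Theory.Kuratowski"
    "Jordan_Normal_Form.Spectral_Radius"
    "HOL-Library.Disjoint_Sets"
begin

(* A finite simple graph is a pair_graph of Graph_Theory: a finite vertex set pverts G with an
   irreflexive symmetric relation parcs G on it. Every undirected edge is thus stored as two arcs,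
   and edges G forgets the orientation. *)
definition edges :: "'a pair_pre_digraph \<Rightarrow> 'a set set" where
  "edges G = {{u, v} | u v. (u, v) \<in> parcs G}"

definition neighbourhood :: "'a pair_pre_digraph \<Rightarrow> 'a \<Rightarrow> 'a set" where
  "neighbourhood G v = {w. (v, w) \<in> parcs G}"

(* Meaningful only if G has an edge: Max of the empty set is unspecified. *)
definition booksize :: "'a pair_pre_digraph \<Rightarrow> nat" where
  "booksize G = Max {card (neighbourhood G u \<inter> neighbourhood G v) | u v. (u, v) \<in> parcs G}"

(* Rows and columns are indexed by the positions in vs, a list that is meant to enumerate the
   vertices of G without repetition. The entries are complex because the library's
   spectral_radius is defined for complex matrices. *)
definition adjacency_matrix :: "'a pair_pre_digraph \<Rightarrow> 'a list \<Rightarrow> complex mat" where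
  "adjacency_matrix G vs =
     mat (length vs) (length vs) (\<lambda>(i, j). if (vs ! i, vs ! j) \<in> parcs G then 1 else 0)"

definition complete_bipartite :: "'a pair_pre_digraph \<Rightarrow> bool" where
  "complete_bipartite G \<longleftrightarrow>
     (\<exists>p q. p > 0 \<and> q > 0 \<and> complete_bipartite_digraph p q (with_proj G))"

definition complete_multipartite :: "'a pair_pre_digraph \<Rightarrow> 'a set set \<Rightarrow> bool" where
  "complete_multipartite G P \<longleftrightarrow> partition_on (pverts G) P \<and>
     (\<forall>u\<in>pverts G. \<forall>v\<in>pverts G. (u, v) \<in> parcs G \<longleftrightarrow> \<not> (\<exists>A\<in>P. u \<in> A \<and> v \<in> A))"

definition regular_complete_multipartite :: "'a pair_pre_digraph \<Rightarrow> bool" where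
  "regular_complete_multipartite G \<longleftrightarrow>
     (\<exists>P. complete_multipartite G P \<and> (\<forall>A\<in>P. \<forall>B\<in>P. card A = card B))"

end

theory Submission
  imports Defs
begin

text \<open>
  Let \<open>d\<close> be the degree vector, \<open>b\<close> the booksize and \<open>A\<close> the adjacency matrix. Counting the arcs
  that meet the neighbourhood of \<open>w\<close> by inclusion-exclusion gives \<open>2 A d \<le> b d + 2 m\<close> entrywise;
  the defect at \<open>w\<close> vanishes iff every edge at \<open>w\<close> lies in exactly \<open>b\<close> triangles and every edge
  meets the neighbourhood of \<open>w\<close>. The entrywise modulus \<open>y\<close> of an eigenvector for an eigenvalue
  of largest modulus satisfies \<open>A y \<ge> \<lambda> y\<close>, and pairing the inequality with \<open>y\<close> gives the bound.
  Equality forces \<open>A y = \<lambda> y\<close> with \<open>y > 0\<close>, so all defects vanish: non-adjacency is then transitive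
  and the sizes of any two distinct parts have the same sum. Conversely, if all defects vanish, then
  \<open>d + c\<close> is an eigenvector, for a suitable constant \<open>c\<close>, whose eigenvalue attains the bound.
\<close>

lemma norm_eigenvalue_le_spectral_radius:
  assumes "A \<in> carrier_mat n n" "eigenvalue A k"
  shows "cmod k \<le> spectral_radius A"
proof (rule spectral_radius_mem_max(2)[OF assms(1)])
  show "n > 0"
    using eigenvalue_imp_nonzero_dim[OF assms] .
  show "cmod k \<in> norm ` spectrum A"
    unfolding spectrum_def using assms(2) by blast
qed

section \<open>Neighbourhoods, arcs and codegrees\<close>

context pair_graph
begin

abbreviation nb :: "'a \<Rightarrow> 'a set" where
  "nb \<equiv> neighbourhood G"

lemma nb_iff: "v \<in> nb u \<longleftrightarrow> (u, v) \<in> parcs G"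
  by (simp add: neighbourhood_def)

lemma arc_sym: "(u, v) \<in> parcs G \<Longrightarrow> (v, u) \<in> parcs G"
  using pair_sym_arcs by (auto simp: symmetric_def dest: symD)

lemma arc_irrefl: "(u, u) \<notin> parcs G"
  using pair_no_loops by fastforce

lemma nb_commute: "v \<in> nb u \<longleftrightarrow> u \<in> nb v"
  using arc_sym by (auto simp: nb_iff)

lemma nb_subset: "nb u \<subseteq> pverts G"
  using in_arcsD2 by (auto simp: nb_iff)

lemma finite_nb [simp]: "finite (nb u)"
  using nb_subset pair_finite_verts by (rule finite_subset)

text \<open>Both sides run over all arcs, one of them after reversal. This is the symmetry of the
  adjacency operator.\<close>

lemma sum_nb_swap:
  "(\<Sum>u\<in>pverts G. \<Sum>v\<in>nb u. f u v) = (\<Sum>v\<in>pverts G. \<Sum>u\<in>nb v. f u v)"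
proof -
  have "(\<Sum>u\<in>pverts G. \<Sum>v\<in>nb u. f u v)
      = (\<Sum>u\<in>pverts G. \<Sum>v | v \<in> pverts G \<and> v \<in> nb u. f u v)"
    using nb_subset by (intro sum.cong refl) blast
  also have "\<dots> = (\<Sum>v\<in>pverts G. \<Sum>u | u \<in> pverts G \<and> v \<in> nb u. f u v)"
    by (rule sum.swap_restrict[OF pair_finite_verts pair_finite_verts])
  also have "\<dots> = (\<Sum>v\<in>pverts G. \<Sum>u\<in>nb v. f u v)"
    using nb_subset nb_commute by (intro sum.cong refl) blast
  finally show ?thesis .
qed

text \<open>Arcs are grouped by their underlying edge; irreflexivity makes every fibre consist of
  exactly two orientations.\<close>

lemma card_parcs: "card (parcs G) = 2 * card (edges G)"
proof -
  let ?g = "\<lambda>(u, v). {u, v}"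
  have img: "edges G = ?g ` parcs G"
    by (auto simp: edges_def)
  have two: "card {p \<in> parcs G. ?g p = e} = 2" if e: "e \<in> edges G" for e
  proof -
    obtain u v where uv: "(u, v) \<in> parcs G" "e = {u, v}"
      using e by (auto simp: edges_def)
    have "{p \<in> parcs G. ?g p = e} = {(u, v), (v, u)}"
      using uv arc_sym by (auto simp: doubleton_eq_iff)
    moreover have "u \<noteq> v"
      using uv arc_irrefl by auto
    ultimately show ?thesis
      by simp
  qed
  have "card (parcs G) = (\<Sum>e\<in>edges G. card {p \<in> parcs G. ?g p = e})"
    using sum.group[of "parcs G" "edges G" ?g "\<lambda>_. 1::nat"] pair_finite_arcs img by simp
  then show ?thesis
    using two by simp
qed

lemma finite_booksize_set:
  "finite {card (nb u \<inter> nb v) | u v. (u, v) \<in> parcs G}"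
proof -
  have "{card (nb u \<inter> nb v) | u v. (u, v) \<in> parcs G} = (\<lambda>(u, v). card (nb u \<inter> nb v)) ` parcs G"
    by auto
  then show ?thesis
    using pair_finite_arcs by simp
qed

lemma codegree_le_booksize: "(u, v) \<in> parcs G \<Longrightarrow> card (nb u \<inter> nb v) \<le> booksize G"
  unfolding booksize_def by (rule Max_ge[OF finite_booksize_set]) blast

text \<open>The arc in the first hypothesis keeps the set under \<open>Max\<close> nonempty.\<close>

lemma booksize_eqI:
  assumes "(u, v) \<in> parcs G"
    and "\<And>u v. (u, v) \<in> parcs G \<Longrightarrow> card (nb u \<inter> nb v) = k"
  shows "booksize G = k"
proof -
  have "{card (nb u \<inter> nb v) | u v. (u, v) \<in> parcs G} = {k}"
    using assms by (auto intro: sym)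
  then show ?thesis
    by (simp add: booksize_def)
qed

section \<open>The defect of a vertex\<close>

text \<open>The exact slack in the degree inequality at \<open>w\<close>: the triangles that the
  edges at \<open>w\<close> lack, plus the arcs, in both orientations, that avoid its neighbourhood.
  By \<open>codegree_le_booksize\<close> no subtraction is truncated.\<close>

definition defect :: "'a \<Rightarrow> nat" where
  "defect w = (\<Sum>u\<in>nb w. booksize G - card (nb w \<inter> nb u)) +
     card {(u, v) \<in> parcs G. u \<notin> nb w \<and> v \<notin> nb w}"

text \<open>Inclusion-exclusion for the arcs with tail, respectively head, in the neighbourhood of \<open>w\<close>.\<close>

lemma degree_sum_defect:
  "2 * (\<Sum>u\<in>nb w. card (nb u)) + defect w = booksize G * card (nb w) + card (parcs G)"
proof -
  \<comment> \<open>\<open>?P\<close> holds the arcs with tail in \<open>nb w\<close>, its reversal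
    \<open>?Q\<close> those with head there, \<open>?C\<close> those with both ends there and
    \<open>?R\<close> those with neither. The factor 2 arises because \<open>?P\<close> and
    \<open>?Q\<close> are equinumerous.\<close>
  let ?P = "Sigma (nb w) nb" and ?C = "Sigma (nb w) (\<lambda>u. nb w \<inter> nb u)"
    and ?R = "{(u, v) \<in> parcs G. u \<notin> nb w \<and> v \<notin> nb w}"
  let ?Q = "prod.swap ` ?P"
  have fin: "finite ?P" "finite ?Q" "finite ?R"
    using pair_finite_arcs by (auto intro: finite_subset[of _ "parcs G"])
  have cP: "card ?P = (\<Sum>u\<in>nb w. card (nb u))"
    by simp
  have cQ: "card ?Q = card ?P"
    by (rule card_image) simp
  have PQ: "?P \<inter> ?Q = ?C"
    using nb_commute by (auto simp: image_iff)
  have cC: "card ?C = (\<Sum>u\<in>nb w. card (nb w \<inter> nb u))"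
    by simp
  have E: "parcs G = (?P \<union> ?Q) \<union> ?R"
    using arc_sym by (auto simp: nb_iff image_iff)
  have "(?P \<union> ?Q) \<inter> ?R = {}"
    by auto
  then have "card (parcs G) = card (?P \<union> ?Q) + card ?R"
    using fin by (subst E, subst card_Un_disjoint) auto
  moreover have "card ?P + card ?Q = card (?P \<union> ?Q) + card ?C"
    using card_Un_Int[OF fin(1,2)] PQ by simp
  moreover have "(\<Sum>u\<in>nb w. booksize G - card (nb w \<inter> nb u)) + card ?C = booksize G * card (nb w)"
  proof -
    have "(\<Sum>u\<in>nb w. booksize G - card (nb w \<inter> nb u)) + card ?C
        = (\<Sum>u\<in>nb w. (booksize G - card (nb w \<inter> nb u)) + card (nb w \<inter> nb u))"
      unfolding cC sum.distrib ..
    also have "\<dots> = (\<Sum>u\<in>nb w. booksize G)"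
      using codegree_le_booksize by (intro sum.cong) (auto simp: nb_iff)
    finally show ?thesis
      by (simp add: mult.commute)
  qed
  ultimately show ?thesis
    using cP cQ unfolding defect_def by linarith
qed

lemma defect_eq_0_iff:
  "defect w = 0 \<longleftrightarrow> (\<forall>u\<in>nb w. card (nb w \<inter> nb u) = booksize G) \<and>
     (\<forall>(u, v)\<in>parcs G. u \<in> nb w \<or> v \<in> nb w)"
proof -
  have "finite {(u, v) \<in> parcs G. u \<notin> nb w \<and> v \<notin> nb w}"
    by (rule finite_subset[OF _ pair_finite_arcs]) auto
  moreover have "booksize G - card (nb w \<inter> nb u) = 0 \<longleftrightarrow> card (nb w \<inter> nb u) = booksize G"
    if "u \<in> nb w" for u
    using codegree_le_booksize[of w u] that by (auto simp: nb_iff)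
  ultimately show ?thesis
    unfolding defect_def by auto
qed

section \<open>Vanishing defects and the extremal graphs\<close>

text \<open>The neighbourhood of a vertex is the complement of its part, so the common neighbourhood
  of \<open>u\<close> and \<open>v\<close> is the complement of the disjoint union of
  \<open>A\<close> and \<open>B\<close>.\<close>

lemma codegree_complete_multipartite:
  assumes P: "complete_multipartite G P" and A: "A \<in> P" "u \<in> A" and B: "B \<in> P" "v \<in> B"
    and uv: "(u, v) \<in> parcs G"
  shows "card (nb u \<inter> nb v) + card A + card B = card (pverts G)"
proof -
  have part: "partition_on (pverts G) P"
    and adj: "\<And>a b. a \<in> pverts G \<Longrightarrow> b \<in> pverts G \<Longrightarrow>
      (a, b) \<in> parcs G \<longleftrightarrow> \<not> (\<exists>C\<in>P. a \<in> C \<and> b \<in> C)"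
    using P by (auto simp: complete_multipartite_def)
  have sub: "A \<subseteq> pverts G" "B \<subseteq> pverts G"
    using part A B by (auto simp: partition_on_def)
  have "A \<noteq> B"
    using adj[of u v] uv A B sub by blast
  then have disj: "A \<inter> B = {}"
    using part A B by (auto simp: partition_on_def disjoint_def)
  have uniq: "C = D" if "C \<in> P" "D \<in> P" "x \<in> C" "x \<in> D" for C D x
    using part that by (auto simp: partition_on_def disjoint_def)
  have nb_part: "nb x = pverts G - C" if "C \<in> P" "x \<in> C" "x \<in> pverts G" for C x
  proof (rule Set.set_eqI)
    fix z
    have "(\<exists>D\<in>P. x \<in> D \<and> z \<in> D) \<longleftrightarrow> z \<in> C"
      using that uniq by blast
    then show "z \<in> nb x \<longleftrightarrow> z \<in> pverts G - C"
      using adj[of x z] that(3) nb_subset[of x] by (auto simp: nb_iff)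
  qed
  have nbu: "nb u = pverts G - A" and nbv: "nb v = pverts G - B"
    using nb_part A B sub by auto
  have "pverts G = (nb u \<inter> nb v) \<union> (A \<union> B)"
    using nbu nbv sub by auto
  moreover have "(nb u \<inter> nb v) \<inter> (A \<union> B) = {}"
    using nbu nbv by auto
  moreover have "finite A" "finite B"
    using sub pair_finite_verts by (auto intro: finite_subset)
  ultimately have "card (pverts G) = card (nb u \<inter> nb v) + card (A \<union> B)"
    by (metis card_Un_disjoint finite_Un finite_Int finite_nb)
  then show ?thesis
    using \<open>finite A\<close> \<open>finite B\<close> disj by (simp add: card_Un_disjoint)
qed

text \<open>The second half of \<open>defect_eq_0_iff\<close> makes non-adjacency an equivalence
  relation, whose classes are the parts; the first half fixes the codegree of every edge and thereby
  constrains the part sizes.\<close>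

lemma defect_0_imp_extremal:
  assumes def0: "\<forall>w\<in>pverts G. defect w = 0"
  shows "complete_bipartite G \<or> regular_complete_multipartite G"
proof -
  define r where "r = {(u, v). u \<in> pverts G \<and> v \<in> pverts G \<and> v \<notin> nb u}"
  define P where "P = pverts G // r"
  have codeg: "card (nb u \<inter> nb v) = booksize G" if "(u, v) \<in> parcs G" for u v
    using def0 that in_arcsD1[OF that] by (auto simp: defect_eq_0_iff nb_iff)
  have equiv: "equiv (pverts G) r"
  proof (rule equivI)
    show "r \<subseteq> pverts G \<times> pverts G"
      by (auto simp: r_def)
    show "refl_on (pverts G) r"
      using arc_irrefl by (auto simp: refl_on_def r_def nb_iff)
    show "sym r"
      using nb_commute by (auto simp: sym_def r_def)
    show "trans r"
    proof (rule transI)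
      fix x y z assume "(x, y) \<in> r" "(y, z) \<in> r"
      \<comment> \<open>Were \<open>x\<close> and \<open>z\<close> adjacent, their edge would have
        to meet the neighbourhood of \<open>y\<close>.\<close>
      moreover have "x \<in> nb y \<or> z \<in> nb y" if "(x, z) \<in> parcs G" "y \<in> pverts G"
        using def0 that by (auto simp: defect_eq_0_iff)
      ultimately show "(x, z) \<in> r"
        using nb_commute by (auto simp: r_def nb_iff)
    qed
  qed
  have part: "partition_on (pverts G) P"
    unfolding P_def by (rule partition_on_quotient[OF equiv])
  have same: "(\<exists>A\<in>P. u \<in> A \<and> v \<in> A) \<longleftrightarrow> (u, v) \<in> r" for u v
  proof
    assume "\<exists>A\<in>P. u \<in> A \<and> v \<in> A"
    then show "(u, v) \<in> r"
      using equiv unfolding P_def by (meson quotient_eq_iff)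
  next
    assume uv: "(u, v) \<in> r"
    then have "u \<in> pverts G"
      by (simp add: r_def)
    then have "r `` {u} \<in> P" "u \<in> r `` {u}" "v \<in> r `` {u}"
      using uv equiv_class_self[OF equiv] by (auto simp: P_def intro: quotientI)
    then show "\<exists>A\<in>P. u \<in> A \<and> v \<in> A"
      by blast
  qed
  have multi: "complete_multipartite G P"
    using part same by (auto simp: complete_multipartite_def r_def nb_iff)
  have adj: "(u, v) \<in> parcs G"
    if "A \<in> P" "B \<in> P" "A \<noteq> B" "u \<in> A" "v \<in> B" for u v A B
  proof -
    have "C = A" "C = B" if "C \<in> P" "u \<in> C" "v \<in> C" for C
      using part that \<open>A \<in> P\<close> \<open>B \<in> P\<close> \<open>u \<in> A\<close> \<open>v \<in> B\<close>
      by (auto simp: partition_on_def disjoint_def)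
    then have "\<not> (\<exists>C\<in>P. u \<in> C \<and> v \<in> C)"
      using \<open>A \<noteq> B\<close> by blast
    moreover have "u \<in> pverts G" "v \<in> pverts G"
      using part that by (auto simp: partition_on_def)
    ultimately show ?thesis
      using multi by (auto simp: complete_multipartite_def)
  qed
  have nonempty: "A \<noteq> {}" if "A \<in> P" for A
    using part that by (auto simp: partition_on_def)
  have sizes: "booksize G + card A + card B = card (pverts G)"
    if AB: "A \<in> P" "B \<in> P" "A \<noteq> B" for A B
  proof -
    obtain u v where uv: "u \<in> A" "v \<in> B"
      using nonempty[OF AB(1)] nonempty[OF AB(2)] by auto
    note e = adj[OF AB uv]
    show ?thesis
      using codegree_complete_multipartite[OF multi AB(1) uv(1) AB(2) uv(2) e] codeg[OF e] by simp
  qed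
  show ?thesis
  proof (cases "\<exists>A\<in>P. \<exists>B\<in>P. card A \<noteq> card B")
    case False
    then show ?thesis
      using multi by (auto simp: regular_complete_multipartite_def)
  next
    case True
    then obtain A B where AB: "A \<in> P" "B \<in> P" "card A \<noteq> card B"
      by blast
    \<comment> \<open>A third part, compared with \<open>A\<close> and with \<open>B\<close>, would
      force \<open>card A = card B\<close>.\<close>
    have "C = A \<or> C = B" if "C \<in> P" for C
      using sizes[of A C] sizes[of B C] AB that by fastforce
    then have PAB: "P = {A, B}"
      using AB by auto
    have V: "pverts G = A \<union> B" and disj: "A \<inter> B = {}"
      using part AB unfolding PAB by (auto simp: partition_on_def disjoint_def)
    have "parcs G = A \<times> B \<union> B \<times> A"
    proof
      show "A \<times> B \<union> B \<times> A \<subseteq> parcs G"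
        using adj AB by auto
      show "parcs G \<subseteq> A \<times> B \<union> B \<times> A"
      proof (rule subrelI)
        fix u v assume uv: "(u, v) \<in> parcs G"
        then have "u \<in> A \<union> B" "v \<in> A \<union> B" "\<not> (\<exists>C\<in>P. u \<in> C \<and> v \<in> C)"
          using in_arcsD1[OF uv] in_arcsD2[OF uv] multi V
          unfolding complete_multipartite_def by blast+
        then show "(u, v) \<in> A \<times> B \<union> B \<times> A"
          unfolding PAB by blast
      qed
    qed
    moreover have "card A > 0" "card B > 0"
      using nonempty AB pair_finite_verts V by (auto simp: card_gt_0_iff)
    ultimately have "complete_bipartite G"
      unfolding complete_bipartite_def complete_bipartite_digraph_pair_def
      using V disj pair_finite_verts by blast
    then show ?thesis ..
  qed
qed

lemma extremal_imp_defect_0: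
  assumes ext: "complete_bipartite G \<or> regular_complete_multipartite G"
    and w: "w \<in> pverts G" and ne: "parcs G \<noteq> {}"
  shows "defect w = 0"
  using ext
proof
  obtain a b where ab: "(a, b) \<in> parcs G"
    using ne by auto
  {
    assume "complete_bipartite G"
    then obtain U V where UV: "pverts G = U \<union> V" "U \<inter> V = {}" "parcs G = U \<times> V \<union> V \<times> U"
      unfolding complete_bipartite_def complete_bipartite_digraph_pair_def by blast
    have empty: "nb u \<inter> nb v = {}" if "(u, v) \<in> parcs G" for u v
      using that UV by (auto simp: nb_iff)
    \<comment> \<open>A bipartite graph has no triangles. The other half of the criterion holds
      because every edge has an end in the side opposite to \<open>w\<close>.\<close>
    have "booksize G = 0"
      by (rule booksize_eqI[OF ab]) (simp add: empty)
    then show "defect w = 0"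
      using w UV empty by (auto simp: defect_eq_0_iff nb_iff)
  next
    assume "regular_complete_multipartite G"
    then obtain P where P: "complete_multipartite G P"
      and reg: "\<And>A B. A \<in> P \<Longrightarrow> B \<in> P \<Longrightarrow> card A = card B"
      by (auto simp: regular_complete_multipartite_def)
    have part: "partition_on (pverts G) P"
      and adj: "\<And>a b. a \<in> pverts G \<Longrightarrow> b \<in> pverts G \<Longrightarrow>
        (a, b) \<in> parcs G \<longleftrightarrow> \<not> (\<exists>C\<in>P. a \<in> C \<and> b \<in> C)"
      using P by (auto simp: complete_multipartite_def)
    have mem: "\<exists>A\<in>P. u \<in> A" if "u \<in> pverts G" for u
      using part that by (auto simp: partition_on_def)
    obtain A where A: "A \<in> P"
      using mem w by blast
    \<comment> \<open>All parts have the size of \<open>A\<close>, so the codegree plus twice that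
      size is the number of vertices and the subtraction is exact.\<close>
    have codeg: "card (nb u \<inter> nb v) = card (pverts G) - 2 * card A" if uv: "(u, v) \<in> parcs G" for u v
    proof -
      obtain B C where "B \<in> P" "u \<in> B" "C \<in> P" "v \<in> C"
        using mem in_arcsD1[OF uv] in_arcsD2[OF uv] by blast
      then show ?thesis
        using codegree_complete_multipartite[OF P _ _ _ _ uv, of B C] reg[of B A] reg[of C A] A
        by simp
    qed
    have bk: "booksize G = card (pverts G) - 2 * card A"
      by (rule booksize_eqI[OF ab codeg])
    \<comment> \<open>Vertices not adjacent to \<open>w\<close> lie in the part of \<open>w\<close>,
      so no two of them are adjacent.\<close>
    have "u \<in> nb w \<or> v \<in> nb w" if uv: "(u, v) \<in> parcs G" for u v
    proof (rule ccontr)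
      assume "\<not> ?thesis"
      then obtain C D where "C \<in> P" "D \<in> P" "w \<in> C" "u \<in> C" "w \<in> D" "v \<in> D"
        using adj w in_arcsD1[OF uv] in_arcsD2[OF uv] by (auto simp: nb_iff)
      moreover from this have "C = D"
        using part by (auto simp: partition_on_def disjoint_def)
      ultimately show False
        using adj uv in_arcsD1[OF uv] in_arcsD2[OF uv] by blast
    qed
    then show "defect w = 0"
      using bk codeg by (auto simp: defect_eq_0_iff nb_iff)
  }
qed

section \<open>The inequality and its equality case for a nonnegative subeigenvector\<close>

text \<open>Pairing \<open>degree_sum_defect\<close> with \<open>y\<close> leaves two nonnegative
  slacks: one weighs the defects by \<open>y\<close>, the other measures how far \<open>y\<close> is
  from an eigenvector. Equality kills both; then \<open>y\<close> is shown to be positive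
  everywhere, so that every single defect vanishes.\<close>

lemma booksize_bound:
  fixes y :: "'a \<Rightarrow> real" and lam :: real
  assumes iso: "\<forall>v\<in>pverts G. nb v \<noteq> {}"
    and lam: "lam > 0"
    and y0: "\<And>v. v \<in> pverts G \<Longrightarrow> y v \<ge> 0"
    and sub: "\<And>v. v \<in> pverts G \<Longrightarrow> lam * y v \<le> (\<Sum>w\<in>nb v. y w)"
    and a: "a \<in> pverts G" "y a > 0"
  shows "real (booksize G) \<ge> 2 * lam - card (parcs G) / lam"
    and "real (booksize G) = 2 * lam - card (parcs G) / lam \<Longrightarrow> w \<in> pverts G \<Longrightarrow> defect w = 0"
proof -
  note finV = pair_finite_verts
  define e where "e = real (card (parcs G))"
  define b where "b = real (booksize G)"
  \<comment> \<open>With A the adjacency operator and d the degree vector, \<open>S\<close>,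
    \<open>D\<close> and \<open>R\<close> pair \<open>y\<close> with 1, with d and with the defects;
    \<open>T\<close> pairs d with A y.\<close>
  define S where "S = (\<Sum>v\<in>pverts G. y v)"
  define D where "D = (\<Sum>v\<in>pverts G. card (nb v) * y v)"
  define R where "R = (\<Sum>v\<in>pverts G. y v * defect v)"
  define T where "T = (\<Sum>v\<in>pverts G. card (nb v) * (\<Sum>w\<in>nb v. y w))"
  have deg: "card (nb v) > 0" if "v \<in> pverts G" for v
    using iso that by (simp add: card_gt_0_iff)
  have S: "S > 0"
    unfolding S_def using finV a y0 by (intro sum_pos2[of _ a]) auto
  have R0: "R \<ge> 0"
    unfolding R_def by (intro sum_nonneg) (simp add: y0)
  \<comment> \<open>As d = A 1, symmetry turns the pairing of d with \<open>y\<close> into that of 1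
    with A y.\<close>
  have "D = (\<Sum>v\<in>pverts G. \<Sum>w\<in>nb v. y v)"
    by (simp add: D_def)
  also have "\<dots> = (\<Sum>v\<in>pverts G. \<Sum>w\<in>nb v. y w)"
    by (rule sum_nb_swap)
  also have "\<dots> \<ge> (\<Sum>v\<in>pverts G. lam * y v)"
    by (intro sum_mono sub)
  finally have DS: "D \<ge> lam * S"
    by (simp add: S_def sum_distrib_left)
  \<comment> \<open>Symmetry moves A from \<open>y\<close> to d, where
    \<open>degree_sum_defect\<close> applies pointwise.\<close>
  have "T = (\<Sum>v\<in>pverts G. \<Sum>w\<in>nb v. card (nb v) * y w)"
    by (simp add: T_def sum_distrib_left)
  also have "\<dots> = (\<Sum>w\<in>pverts G. \<Sum>v\<in>nb w. card (nb v) * y w)"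
    by (rule sum_nb_swap)
  also have "2 * \<dots> + R = (\<Sum>w\<in>pverts G. y w * (2 * (\<Sum>v\<in>nb w. real (card (nb v))) + defect w))"
    by (simp add: R_def sum.distrib sum_distrib_left sum_distrib_right algebra_simps)
  also have "\<dots> = (\<Sum>w\<in>pverts G. y w * (b * card (nb w) + e))"
  proof (rule sum.cong[OF refl])
    fix w
    have "2 * (\<Sum>v\<in>nb w. real (card (nb v))) + real (defect w) = b * card (nb w) + e"
      using arg_cong[OF degree_sum_defect[of w], of real] by (simp add: b_def e_def)
    then show "y w * (2 * (\<Sum>v\<in>nb w. real (card (nb v))) + defect w) = y w * (b * card (nb w) + e)"
      by simp
  qed
  also have "\<dots> = b * D + e * S"
    by (simp add: D_def S_def sum.distrib sum_distrib_left algebra_simps)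
  finally have id: "2 * T + R = b * D + e * S" .
  have "T \<ge> (\<Sum>v\<in>pverts G. card (nb v) * (lam * y v))"
    unfolding T_def by (intro sum_mono mult_left_mono sub) auto
  then have T: "T \<ge> lam * D"
    by (simp add: D_def sum_distrib_left mult.left_commute)
  have D: "D > 0"
    using DS S lam by (smt (verit) mult_pos_pos)
  have eS: "e * S \<le> e / lam * D"
  proof -
    have "e / lam * (lam * S) \<le> e / lam * D"
      using DS lam by (intro mult_left_mono) (auto simp: e_def)
    then show ?thesis
      using lam by simp
  qed
  \<comment> \<open>This is \<open>id\<close> with \<open>e * S\<close> replaced by its upper bound
    \<open>e / lam * D\<close>.\<close>
  have key: "(2 * lam - e / lam - b) * D + R + 2 * (T - lam * D) \<le> 0"
    using id eS by (simp add: algebra_simps)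
  then have "(2 * lam - e / lam - b) * D \<le> 0"
    using R0 T by simp
  then show "real (booksize G) \<ge> 2 * lam - card (parcs G) / lam"
    using D by (simp add: mult_le_0_iff e_def b_def)
  assume eq: "real (booksize G) = 2 * lam - card (parcs G) / lam" and w: "w \<in> pverts G"
  have "R + 2 * (T - lam * D) \<le> 0"
    using key eq by (simp add: e_def b_def)
  then have "R = 0" and "T - lam * D = 0"
    using R0 T by auto
  have zero: "y v = 0 \<or> defect v = 0" if "v \<in> pverts G" for v
  proof -
    have "y v * defect v = 0"
      using \<open>R = 0\<close> that sum_nonneg_eq_0_iff[OF finV, of "\<lambda>v. y v * defect v"] y0
      by (simp add: R_def)
    then show ?thesis
      by simp
  qed
  have "T - lam * D = (\<Sum>v\<in>pverts G. card (nb v) * ((\<Sum>w\<in>nb v. y w) - lam * y v))"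
    by (simp add: T_def D_def sum_distrib_left sum_subtractf algebra_simps)
  then have "card (nb v) * ((\<Sum>w\<in>nb v. y w) - lam * y v) = 0" if "v \<in> pverts G" for v
    using \<open>T - lam * D = 0\<close> that sub
      sum_nonneg_eq_0_iff[OF finV, of "\<lambda>v. card (nb v) * ((\<Sum>w\<in>nb v. y w) - lam * y v)"]
    by simp
  \<comment> \<open>Without isolated vertices the degree factor can be cancelled.\<close>
  then have eig: "(\<Sum>w\<in>nb v. y w) = lam * y v" if "v \<in> pverts G" for v
    using deg[OF that] that by fastforce
  \<comment> \<open>The eigenvector equation spreads positivity to neighbours.\<close>
  have step: "y v > 0" if "u \<in> pverts G" "y u > 0" "v \<in> nb u" for u v
  proof -
    have "0 < (\<Sum>w\<in>nb v. y w)"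
      using that y0 nb_subset nb_commute by (intro sum_pos2[of _ u]) auto
    then show ?thesis
      using eig[of v] that(3) nb_subset[of u] lam by (auto simp: zero_less_mult_iff)
  qed
  obtain v where v: "v \<in> nb w"
    using iso w by auto
  \<comment> \<open>This takes the place of connectedness: every edge, in particular the one from
    \<open>w\<close> to \<open>v\<close>, meets the neighbourhood of \<open>a\<close>, so
    \<open>w\<close> is reached from \<open>a\<close> in at most two steps.\<close>
  have "defect a = 0"
    using zero a by fastforce
  then consider "w \<in> nb a" | "v \<in> nb a"
    using v by (auto simp: defect_eq_0_iff nb_iff)
  then have "y w > 0"
  proof cases
    case 1
    then show ?thesis
      by (rule step[OF a])
  next
    case 2
    then have "y v > 0" "v \<in> pverts G" "w \<in> nb v"
      using step[OF a] v nb_subset nb_commute by auto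
    then show ?thesis
      using step by blast
  qed
  then show "defect w = 0"
    using zero[OF w] by simp
qed

section \<open>The adjacency matrix as an operator on vertex functions\<close>

lemma sum_nb_conv_index:
  assumes "distinct vs" "set vs = pverts G"
  shows "(\<Sum>w\<in>nb v. f w) = (\<Sum>j<length vs. if (v, vs ! j) \<in> parcs G then f (vs ! j) else 0)"
proof -
  have "nb v = {w \<in> pverts G. (v, w) \<in> parcs G}"
    using nb_subset by (auto simp: nb_iff)
  then have "(\<Sum>w\<in>nb v. f w) = (\<Sum>w\<in>pverts G. if (v, w) \<in> parcs G then f w else 0)"
    using pair_finite_verts by (simp add: sum.inter_filter)
  also have "\<dots> = (\<Sum>j<length vs. if (v, vs ! j) \<in> parcs G then f (vs ! j) else 0)"
    using sum.reindex_bij_betw[OF bij_betw_nth[OF assms(1) refl assms(2)[symmetric]],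
        of "\<lambda>w. if (v, w) \<in> parcs G then f w else 0"] by simp
  finally show ?thesis .
qed

lemma adjacency_matrix_carrier [simp]:
  "adjacency_matrix G vs \<in> carrier_mat (length vs) (length vs)"
  by (simp add: adjacency_matrix_def)

lemma adjacency_matrix_mult_vec:
  assumes "distinct vs" "set vs = pverts G" and "z \<in> carrier_vec (length vs)"
    and "\<And>j. j < length vs \<Longrightarrow> z $ j = f (vs ! j)" and "i < length vs"
  shows "(adjacency_matrix G vs *\<^sub>v z) $ i = (\<Sum>w\<in>nb (vs ! i). f w)"
proof -
  have "(adjacency_matrix G vs *\<^sub>v z) $ i
      = (\<Sum>j<length vs. (if (vs ! i, vs ! j) \<in> parcs G then 1 else 0) * f (vs ! j))"
    using assms by (simp add: adjacency_matrix_def scalar_prod_def atLeast0LessThan)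
  also have "\<dots> = (\<Sum>w\<in>nb (vs ! i). f w)"
    unfolding sum_nb_conv_index[OF assms(1,2)] by (intro sum.cong) auto
  finally show ?thesis .
qed

text \<open>Trades vectors indexed by positions in \<open>vs\<close> for functions on vertices, in
  which the combinatorial lemmas are phrased.\<close>

lemma eigenvalue_adjacency_matrix_iff:
  assumes vs: "distinct vs" "set vs = pverts G"
  shows "eigenvalue (adjacency_matrix G vs) k \<longleftrightarrow>
    (\<exists>f. (\<exists>v\<in>pverts G. f v \<noteq> 0) \<and> (\<forall>v\<in>pverts G. (\<Sum>w\<in>nb v. f w) = k * f v))"
    (is "?L \<longleftrightarrow> ?R")
proof
  let ?n = "length vs"
  assume ?L
  then obtain z where z: "z \<in> carrier_vec ?n" "z \<noteq> 0\<^sub>v ?n"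
    and eig: "adjacency_matrix G vs *\<^sub>v z = k \<cdot>\<^sub>v z"
    by (auto simp: eigenvalue_def eigenvector_def adjacency_matrix_def)
  define f where "f v = z $ the_inv_into {..<?n} ((!) vs) v" for v
  have f: "z $ j = f (vs ! j)" if "j < ?n" for j
    using that vs by (simp add: f_def the_inv_into_f_f inj_on_nth)
  have "\<exists>i<?n. z $ i \<noteq> 0"
  proof (rule ccontr)
    assume "\<not> ?thesis"
    then have "z = 0\<^sub>v ?n"
      using z(1) by (intro eq_vecI) auto
    with z(2) show False
      by contradiction
  qed
  then obtain i where "i < ?n" "z $ i \<noteq> 0"
    by blast
  then have "vs ! i \<in> pverts G" "f (vs ! i) \<noteq> 0"
    using f[of i] nth_mem[of i vs] vs(2) by simp_all
  then have "\<exists>v\<in>pverts G. f v \<noteq> 0" ..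
  moreover have "(\<Sum>w\<in>nb v. f w) = k * f v" if "v \<in> pverts G" for v
  proof -
    from that obtain i where i: "i < ?n" "v = vs ! i"
      unfolding vs(2)[symmetric] in_set_conv_nth by auto
    then show ?thesis
      using adjacency_matrix_mult_vec[OF vs z(1) f i(1)] eig z(1) f by simp
  qed
  ultimately show ?R
    by blast
next
  let ?n = "length vs"
  assume ?R
  then obtain f v where v: "v \<in> pverts G" "f v \<noteq> 0"
    and f: "\<And>v. v \<in> pverts G \<Longrightarrow> (\<Sum>w\<in>nb v. f w) = k * f v"
    by blast
  define z where "z = vec ?n (\<lambda>i. f (vs ! i))"
  obtain i where "i < ?n" "v = vs ! i"
    using v unfolding vs(2)[symmetric] in_set_conv_nth by auto
  then have "z \<noteq> 0\<^sub>v ?n"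
    using v by (auto simp: z_def dest!: arg_cong[of _ _ "\<lambda>z. z $ i"])
  moreover have "adjacency_matrix G vs *\<^sub>v z = k \<cdot>\<^sub>v z"
  proof (rule eq_vecI)
    fix i assume "i < dim_vec (k \<cdot>\<^sub>v z)"
    then have i: "i < ?n"
      by (simp add: z_def)
    have "(adjacency_matrix G vs *\<^sub>v z) $ i = (\<Sum>w\<in>nb (vs ! i). f w)"
      by (rule adjacency_matrix_mult_vec[OF vs _ _ i]) (simp_all add: z_def)
    also have "\<dots> = k * f (vs ! i)"
      using i vs nth_mem by (intro f) auto
    finally show "(adjacency_matrix G vs *\<^sub>v z) $ i = (k \<cdot>\<^sub>v z) $ i"
      using i by (simp add: z_def)
  qed (simp add: z_def adjacency_matrix_def)
  ultimately have "eigenvector (adjacency_matrix G vs) z k"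
    by (simp add: eigenvector_def z_def adjacency_matrix_def)
  then show ?L
    by (auto simp: eigenvalue_def)
qed

section \<open>Positivity of the spectral radius and a subeigenvector for it\<close>

text \<open>If the spectral radius vanished, the powers of \<open>B = 2 A\<close> would stay bounded; but along an
  edge \<open>{i, j}\<close> the sum of the \<open>(i, i)\<close> and \<open>(i, j)\<close> entries at least doubles in every step.\<close>

lemma spectral_radius_adjacency_matrix_pos:
  assumes vs: "distinct vs" "set vs = pverts G" and ne: "parcs G \<noteq> {}"
  shows "spectral_radius (adjacency_matrix G vs) > 0"
proof (rule ccontr)
  let ?n = "length vs"
  let ?A = "adjacency_matrix G vs"
  let ?B = "2 \<cdot>\<^sub>m ?A"
  assume neg: "\<not> ?thesis"
  obtain u v where uv: "(u, v) \<in> parcs G"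
    using ne by auto
  obtain i j where i: "i < ?n" "u = vs ! i" and j: "j < ?n" "v = vs ! j"
    using in_arcsD1[OF uv] in_arcsD2[OF uv] unfolding vs(2)[symmetric] in_set_conv_nth by auto
  then have n: "?n > 0"
    by linarith
  have B: "?B \<in> carrier_mat ?n ?n"
    by simp
  have Bentry: "?B $$ (a, b) = (if (vs ! a, vs ! b) \<in> parcs G then 2 else 0)"
    if "a < ?n" "b < ?n" for a b
    using that by (simp add: adjacency_matrix_def)
  \<comment> \<open>Every eigenvalue of \<open>?B\<close> is twice one of \<open>?A\<close>, hence 0
    under the assumption \<open>neg\<close>.\<close>
  have "spectral_radius ?B < 1"
  proof -
    obtain k where k: "eigenvalue ?B k" "spectral_radius ?B = cmod k"
      using spectral_radius_mem_max(1)[OF B n] by (auto simp: spectrum_def)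
    then obtain z where z: "z \<in> carrier_vec ?n" "z \<noteq> 0\<^sub>v ?n" "?B *\<^sub>v z = k \<cdot>\<^sub>v z"
      by (auto simp: eigenvalue_def eigenvector_def adjacency_matrix_def)
    have "?A *\<^sub>v z = (k / 2) \<cdot>\<^sub>v z"
    proof (rule eq_vecI)
      fix a assume "a < dim_vec ((k / 2) \<cdot>\<^sub>v z)"
      then have a: "a < ?n"
        using z by simp
      have "2 * (?A *\<^sub>v z) $ a = (?B *\<^sub>v z) $ a"
        using a z(1) by (simp add: adjacency_matrix_def scalar_prod_def sum_distrib_left algebra_simps)
      then show "(?A *\<^sub>v z) $ a = ((k / 2) \<cdot>\<^sub>v z) $ a"
        using a z by (simp add: mult.commute)
    qed (use z in \<open>simp add: adjacency_matrix_def\<close>)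
    then have "eigenvalue ?A (k / 2)"
      using z by (auto simp: eigenvalue_def eigenvector_def adjacency_matrix_def)
    then have "cmod (k / 2) \<le> spectral_radius ?A"
      by (rule norm_eigenvalue_le_spectral_radius[OF adjacency_matrix_carrier])
    then show ?thesis
      using k neg by (simp add: norm_divide)
  qed
  from spectral_radius_jnf_norm_bound_less_1_upper_triangular[OF B this]
  obtain c where c: "\<And>k. norm_bound (?B ^\<^sub>m k) c"
    by blast
  \<comment> \<open>Entry \<open>(i, b)\<close> is \<open>2 ^ k\<close> times the number of walks of
    length \<open>k\<close> from \<open>i\<close> to \<open>b\<close>. Nonnegativity is carried
    along so that a sum can be bounded below by one of its terms.\<close>
  have grow: "(\<forall>b<?n. Im ((?B ^\<^sub>m k) $$ (i, b)) = 0 \<and> Re ((?B ^\<^sub>m k) $$ (i, b)) \<ge> 0) \<and>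
    Re ((?B ^\<^sub>m k) $$ (i, i)) + Re ((?B ^\<^sub>m k) $$ (i, j)) \<ge> 2 ^ k" for k
  proof (induction k)
    case 0
    then show ?case
      using i j B by (auto simp: adjacency_matrix_def)
  next
    case (Suc k)
    let ?C = "?B ^\<^sub>m k"
    have C: "?C \<in> carrier_mat ?n ?n"
      by (rule pow_carrier_mat[OF B])
    have entry: "(?B ^\<^sub>m Suc k) $$ (i, b) =
        (\<Sum>a<?n. ?C $$ (i, a) * (if (vs ! a, vs ! b) \<in> parcs G then 2 else 0))" if "b < ?n" for b
    proof -
      have "dim_row ?A = ?n" "dim_col ?A = ?n"
        by (simp_all add: adjacency_matrix_def)
      then have "(?B ^\<^sub>m Suc k) $$ (i, b) = (\<Sum>a<?n. ?C $$ (i, a) * ?B $$ (a, b))"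
        using that i C by (simp add: scalar_prod_def atLeast0LessThan)
      also have "\<dots> = (\<Sum>a<?n. ?C $$ (i, a) * (if (vs ! a, vs ! b) \<in> parcs G then 2 else 0))"
        using Bentry[OF _ that] by (intro sum.cong) simp_all
      finally show ?thesis .
    qed
    have re: "Re ((?B ^\<^sub>m Suc k) $$ (i, b)) =
        (\<Sum>a<?n. Re (?C $$ (i, a)) * (if (vs ! a, vs ! b) \<in> parcs G then 2 else 0))" if "b < ?n" for b
      unfolding entry[OF that] Re_sum by (intro sum.cong) auto
    have im: "Im ((?B ^\<^sub>m Suc k) $$ (i, b)) = 0" if "b < ?n" for b
      unfolding entry[OF that] Im_sum using Suc by (intro sum.neutral) auto
    have ge: "Re ((?B ^\<^sub>m Suc k) $$ (i, b)) \<ge> 2 * Re (?C $$ (i, a))"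
      if "a < ?n" "b < ?n" "(vs ! a, vs ! b) \<in> parcs G" for a b
    proof -
      have "Re (?C $$ (i, a)) * (if (vs ! a, vs ! b) \<in> parcs G then 2 else 0)
          \<le> (\<Sum>a<?n. Re (?C $$ (i, a)) * (if (vs ! a, vs ! b) \<in> parcs G then 2 else 0))"
        using Suc that(1) by (intro member_le_sum) auto
      then show ?thesis
        using re that by simp
    qed
    have "Re ((?B ^\<^sub>m Suc k) $$ (i, b)) \<ge> 0" if "b < ?n" for b
      unfolding re[OF that] using Suc by (intro sum_nonneg) auto
    moreover have "Re ((?B ^\<^sub>m Suc k) $$ (i, i)) + Re ((?B ^\<^sub>m Suc k) $$ (i, j)) \<ge> 2 ^ Suc k"
    proof -
      \<comment> \<open>A step along the edge exchanges the two entries, each gaining a factor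
        2.\<close>
      have "Re ((?B ^\<^sub>m Suc k) $$ (i, i)) \<ge> 2 * Re (?C $$ (i, j))"
        using arc_sym[OF uv] i j by (intro ge) simp_all
      moreover have "Re ((?B ^\<^sub>m Suc k) $$ (i, j)) \<ge> 2 * Re (?C $$ (i, i))"
        using uv i j by (intro ge) simp_all
      ultimately show ?thesis
        using conjunct2[OF Suc] by simp
    qed
    ultimately show ?case
      using im by blast
  qed
  have bound: "2 ^ k \<le> 2 * c" for k
  proof -
    have C: "?B ^\<^sub>m k \<in> carrier_mat ?n ?n"
      by (rule pow_carrier_mat[OF B])
    have "cmod ((?B ^\<^sub>m k) $$ (i, b)) \<le> c" if "b < ?n" for b
      using c[of k] i that unfolding norm_bound_def carrier_matD[OF C] by blast
    then have "Re ((?B ^\<^sub>m k) $$ (i, b)) \<le> c" if "b < ?n" for b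
      using complex_Re_le_cmod order_trans that by blast
    from this[OF i(1)] this[OF j(1)] show ?thesis
      using grow[of k] by linarith
  qed
  obtain k where "2 * c < 2 ^ k"
    using real_arch_pow[of 2 "2 * c"] by auto
  with bound[of k] show False
    by simp
qed

text \<open>The triangle inequality applied to the eigenvector equation of an eigenvalue of largest
  modulus. It yields one direction only; \<open>booksize_bound\<close> recovers the other when
  equality holds.\<close>

lemma spectral_radius_subeigenvector:
  assumes vs: "distinct vs" "set vs = pverts G" and ne: "pverts G \<noteq> {}"
  obtains y :: "'a \<Rightarrow> real" and a where
    "\<And>v. y v \<ge> 0" "a \<in> pverts G" "y a > 0"
    "\<And>v. v \<in> pverts G \<Longrightarrow> spectral_radius (adjacency_matrix G vs) * y v \<le> (\<Sum>w\<in>nb v. y w)"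
proof -
  have "length vs > 0"
    using vs ne by auto
  from spectral_radius_mem_max(1)[OF adjacency_matrix_carrier this]
  obtain k where k: "eigenvalue (adjacency_matrix G vs) k"
    and sr: "spectral_radius (adjacency_matrix G vs) = cmod k"
    by (auto simp: spectrum_def)
  obtain f a where a: "a \<in> pverts G" "f a \<noteq> 0"
    and f: "\<And>v. v \<in> pverts G \<Longrightarrow> (\<Sum>w\<in>nb v. f w) = k * f v"
    using k unfolding eigenvalue_adjacency_matrix_iff[OF vs] by blast
  show ?thesis
  proof (rule that[of "\<lambda>v. cmod (f v)" a])
    show "spectral_radius (adjacency_matrix G vs) * cmod (f v) \<le> (\<Sum>w\<in>nb v. cmod (f w))"
      if "v \<in> pverts G" for v
      using norm_sum[of f "nb v"] f[OF that] sr by (simp add: norm_mult)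
  qed (use a in auto)
qed

section \<open>Vanishing defects attain the bound\<close>

text \<open>When all defects vanish, the span of the degree vector and the constant vector is invariant
  under the adjacency operator, with characteristic polynomial \<open>\<mu>\<^sup>2 - b \<mu> / 2 - e / 2\<close>.\<close>

lemma booksize_bound_tight:
  assumes vs: "distinct vs" "set vs = pverts G" and ne: "parcs G \<noteq> {}"
    and def0: "\<And>w. w \<in> pverts G \<Longrightarrow> defect w = 0"
  defines "lam \<equiv> spectral_radius (adjacency_matrix G vs)"
  shows "real (booksize G) \<le> 2 * lam - card (parcs G) / lam"
proof -
  define b where "b = real (booksize G)"
  define e where "e = real (card (parcs G))"
  \<comment> \<open>The positive root of \<open>2 * x * x = b * x + e\<close>. With zero defects A
    (d + c) = (b / 2 + c) d + e / 2; matching this with mu (d + c) forces c = mu - b / 2.\<close>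
  define mu where "mu = (b + sqrt (b\<^sup>2 + 8 * e)) / 4"
  define f where "f v = real (card (nb v)) + (mu - b / 2)" for v
  have e: "e > 0"
    using ne pair_finite_arcs by (simp add: e_def card_gt_0_iff)
  have b: "b \<ge> 0"
    by (simp add: b_def)
  have "sqrt (b\<^sup>2 + 8 * e) > sqrt (b\<^sup>2)"
    using e by (intro real_sqrt_less_mono) simp
  then have sq: "sqrt (b\<^sup>2 + 8 * e) > b"
    using b by simp
  then have mu: "mu > 0" "mu > b / 2"
    using b by (auto simp: mu_def)
  have "4 * mu - b = sqrt (b\<^sup>2 + 8 * e)"
    by (simp add: mu_def field_simps)
  then have "(4 * mu - b)\<^sup>2 = b\<^sup>2 + 8 * e"
    using e by simp
  then have quad: "2 * mu * mu = b * mu + e"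
    by (simp add: power2_eq_square algebra_simps)
  have eig: "(\<Sum>w\<in>nb v. f w) = mu * f v" if "v \<in> pverts G" for v
  proof -
    have "2 * (\<Sum>u\<in>nb v. real (card (nb u))) = b * card (nb v) + e"
      using arg_cong[OF degree_sum_defect[of v], of real] def0[OF that] by (simp add: b_def e_def)
    moreover have "(\<Sum>w\<in>nb v. f w) = (\<Sum>u\<in>nb v. real (card (nb u))) + card (nb v) * (mu - b / 2)"
      by (simp add: f_def sum.distrib)
    ultimately have "2 * (\<Sum>w\<in>nb v. f w) = e + 2 * mu * card (nb v)"
      by (simp add: algebra_simps)
    also have "\<dots> = 2 * (mu * f v)"
      using quad by (simp add: f_def algebra_simps)
    finally show ?thesis
      by simp
  qed
  obtain u v where uv: "(u, v) \<in> parcs G"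
    using ne by auto
  have "f u > 0"
    using mu by (simp add: f_def add_nonneg_pos)
  then have "eigenvalue (adjacency_matrix G vs) (of_real mu)"
    unfolding eigenvalue_adjacency_matrix_iff[OF vs] using eig in_arcsD1[OF uv]
    by (intro exI[of _ "\<lambda>v. of_real (f v)"]) (force simp flip: of_real_sum of_real_mult)
  then have "cmod (of_real mu) \<le> lam"
    unfolding lam_def by (rule norm_eigenvalue_le_spectral_radius[OF adjacency_matrix_carrier])
  then have le: "mu \<le> lam"
    using mu by simp
  have "b = 2 * mu - e / mu"
    using quad mu by (simp add: field_simps)
  \<comment> \<open>Since \<open>2 * x - e / x\<close> increases for positive x,
    \<open>mu \<le> lam\<close> suffices, without identifying \<open>mu\<close> as the largest
    eigenvalue.\<close>
  also have "\<dots> \<le> 2 * lam - e / lam"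
    using le mu e by (intro diff_mono mult_left_mono divide_left_mono) auto
  finally show ?thesis
    by (simp add: b_def e_def)
qed

end

theorem theorem1p6:
  fixes G :: "'a pair_pre_digraph" and vs :: "'a list" and m :: nat and lam :: real
  assumes "pair_graph G"
    and "\<forall>v\<in>pverts G. neighbourhood G v \<noteq> {}"
    and "m = card (edges G)" and "m \<ge> 1"
    and "distinct vs" and "set vs = pverts G"
    and "lam = spectral_radius (adjacency_matrix G vs)"
  shows "real (booksize G) \<ge> 2 * lam - 2 * real m / lam \<and>
    (real (booksize G) = 2 * lam - 2 * real m / lam \<longleftrightarrow>
       complete_bipartite G \<or> regular_complete_multipartite G)"
proof -
  interpret pair_graph G
    by fact
  \<comment> \<open>Each edge gives two arcs, so the arc count in the lemmas is the
    \<open>2 * m\<close> of the bound.\<close>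
  have e: "real (card (parcs G)) = 2 * real m"
    using card_parcs assms(3) by simp
  then have ne: "parcs G \<noteq> {}"
    using assms(4) by auto
  then have "pverts G \<noteq> {}"
    using in_arcsD1 by auto
  from spectral_radius_subeigenvector[OF assms(5,6) this]
  obtain y :: "'a \<Rightarrow> real" and a where y: "\<And>v. y v \<ge> 0" "a \<in> pverts G" "y a > 0"
    "\<And>v. v \<in> pverts G \<Longrightarrow> lam * y v \<le> (\<Sum>w\<in>nb v. y w)"
    unfolding assms(7) by metis
  have lam: "lam > 0"
    using spectral_radius_adjacency_matrix_pos[OF assms(5,6) ne] assms(7) by simp
  have bound: "real (booksize G) \<ge> 2 * lam - 2 * real m / lam"
    using booksize_bound(1)[of lam y, OF assms(2) lam _ _ y(2,3)] y(1,4) e by simp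
  have defect0: "defect w = 0"
    if "real (booksize G) = 2 * lam - 2 * real m / lam" "w \<in> pverts G" for w
    using booksize_bound(2)[of lam y, OF assms(2) lam _ _ y(2,3)] y(1,4) e that by simp
  show ?thesis
  proof (intro conjI iffI)
    show "real (booksize G) \<ge> 2 * lam - 2 * real m / lam"
      by (rule bound)
    show "complete_bipartite G \<or> regular_complete_multipartite G"
      if "real (booksize G) = 2 * lam - 2 * real m / lam"
      using defect_0_imp_extremal defect0[OF that] by blast
    show "real (booksize G) = 2 * lam - 2 * real m / lam"
      if "complete_bipartite G \<or> regular_complete_multipartite G"
      using booksize_bound_tight[OF assms(5,6) ne] extremal_imp_defect_0[OF that _ ne] bound
      by (simp add: e assms(7) order_antisym)
  qed
qed

end
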